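(* Let $q$ be a prime power, $v$ a prime, $\lambda$ a positive integer, and $\Gamma$ a $q$-spaceable simple graph with $s$ edges such that $\lambda([v]_q-1)=2st$ for a positive integer $t$. Assume that $v$ divides $t$ and that $\mathcal{I}$ is a collection of $t/v$ $\Gamma$-subspaces of $\mathrm{PG}(\mathbb{F}_q^v)$ such that $\Delta\mathcal{I}$ is evenly distributed over the $([v]_q-1)/v$ orbits of $\mathrm{Frob}([\mathbb{Z}_v]_q)$ on $[\mathbb{Z}_v]_q^*$. Then $\mathcal{I}$ is a collection of initial base blocks of a $(v,\Gamma,\lambda)$ difference family over $\mathbb{F}_q$, i.e., the family $(B^\alpha)_{B\in\mathcal{I},\,\alpha\in\mathrm{Frob}([\mathbb{Z}_v]_q)}$ is a $(v,\Gamma,\lambda)$ difference family over $\mathbb{F}_q$.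
   Context: $[n]_q=\frac{q^n-1}{q-1}$. The Singer group $[\mathbb{Z}_v]_q=\mathbb{F}_{q^v}^*/\mathbb{F}_q^*$ is cyclic of order $[v]_q$; its elements are identified with the points of $\mathrm{PG}(\mathbb{F}_q^v)$, the $(v-1)$-dimensional projective space over $\mathbb{F}_q$; $[\mathbb{Z}_v]_q^*$ denotes its non-identity elements. $\mathrm{Frob}([\mathbb{Z}_v]_q)=\{\phi^i:0\le i\le v-1\}$ with $\phi(x)=x^q$. A graph is $q$-spaceable if it has $[k]_q$ vertices for some $k$; a $\Gamma$-subspace is a graph isomorphic to $\Gamma$ whose vertex set is a projective subspace. For a graph $B$ with vertices in $[\mathbb{Z}_v]_q$, $\Delta B$ is the multiset of $xy^{-1}$ over ordered pairs $(x,y)$ of adjacent vertices; $\Delta$ of a collection is the multiset union; $B^\alpha$ applies $\alpha$ to the vertices. Evenly distributed: every orbit contains the same number of elements of $\Delta\mathcal{I}$, with multiplicity. A $(v,\Gamma,\lambda)$ difference family over $\mathbb{F}_q$ is a collection of $\Gamma$-subspaces of $\mathrm{PG}(\mathbb{F}_q^v)$ whose list of differences contains every element of $[\mathbb{Z}_v]_q^*$ exactly $\lambda$ times.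
   Formalization: That Frob has exactly ([v]_q−1)/v orbits on the non-identity elements is taken as an explicit hypothesis; it holds exactly when v does not divide q−1, and otherwise the count is not an integer and the conclusion fails (e.g. q=3, v=2). *)

theory Defs
  imports
    "HOL-Algebra.Embedded_Algebras"
    "HOL-Algebra.Multiplicative_Group"
    "HOL-Algebra.Group_Action"
    "HOL-Number_Theory.Prime_Powers"
    "HOL-Library.Multiset"
    "Graph_Theory.Pair_Digraph"
    "Graph_Theory.Digraph_Isomorphism"
begin

text \<open>The division is exact for \<open>q \<ge> 2\<close>.\<close>
definition q_number :: "nat \<Rightarrow> nat \<Rightarrow> nat" where
  "q_number q n = (q ^ n - 1) div (q - 1)"

text \<open>
  A finite simple graph is a \<^const>\<open>pair_graph\<close>: finite, loop-free, with a symmetric set of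
  arcs.  Its arcs are the ordered pairs of adjacent vertices, so each edge yields two arcs.
\<close>
definition graph_edges :: "'a pair_pre_digraph \<Rightarrow> 'a set set" where
  "graph_edges G = {{x, y} | x y. (x, y) \<in> parcs G}"

definition graph_image :: "('a \<Rightarrow> 'b) \<Rightarrow> 'a pair_pre_digraph \<Rightarrow> 'b pair_pre_digraph" where
  "graph_image f G = \<lparr>pverts = f ` pverts G, parcs = map_prod f f ` parcs G\<rparr>"

definition q_spaceable :: "nat \<Rightarrow> 'a pair_pre_digraph \<Rightarrow> bool" where
  "q_spaceable q G \<longleftrightarrow> (\<exists>k. card (pverts G) = q_number q k)"

text \<open>
  For a field \<open>K\<close> of order \<open>q ^ v\<close> with subfield \<open>F\<close> of order \<open>q\<close>.  The elements of the Singer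
  group are the cosets \<open>F\<^sup>* x\<close> with \<open>x \<noteq> 0\<close>, that is, the points of the projective space of
  \<open>K\<close> as an \<open>F\<close>-vector space.
\<close>
definition singer_group :: "('a, 'm) ring_scheme \<Rightarrow> 'a set \<Rightarrow> 'a set monoid" where
  "singer_group K F = mult_of K Mod (F - {\<zero>\<^bsub>K\<^esub>})"

text \<open>
  The library calls an additive subgroup \<open>W\<close> of \<open>K\<close> closed under multiplication by scalars from
  \<open>F\<close>, i.e. an \<open>F\<close>-linear subspace, a \<^const>\<open>subalgebra\<close>.
\<close>
definition projective_subspace :: "('a, 'm) ring_scheme \<Rightarrow> 'a set \<Rightarrow> 'a set set \<Rightarrow> bool" where
  "projective_subspace K F S \<longleftrightarrow>
     (\<exists>W. subalgebra F W K \<and>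
          S = {(F - {\<zero>\<^bsub>K\<^esub>}) #>\<^bsub>mult_of K\<^esub> x | x. x \<in> W - {\<zero>\<^bsub>K\<^esub>}})"

definition graph_subspace ::
  "('a, 'm) ring_scheme \<Rightarrow> 'a set \<Rightarrow> 'g pair_pre_digraph \<Rightarrow> 'a set pair_pre_digraph \<Rightarrow> bool" where
  "graph_subspace K F \<Gamma> B \<longleftrightarrow>
     pair_graph B \<and> digraph_iso (with_proj \<Gamma>) (with_proj B) \<and> projective_subspace K F (pverts B)"

definition frobenius :: "('a, 'm) monoid_scheme \<Rightarrow> nat \<Rightarrow> 'a \<Rightarrow> 'a" where
  "frobenius G q = (\<lambda>x \<in> carrier G. x [^]\<^bsub>G\<^esub> q)"

definition Frob :: "('a, 'm) monoid_scheme \<Rightarrow> nat \<Rightarrow> nat \<Rightarrow> ('a \<Rightarrow> 'a) set" where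
  "Frob G q v = {frobenius G q [^]\<^bsub>AutoGroup G\<^esub> i | i. i \<in> {0..v - 1}}"

definition Frob_orbits :: "('a, 'm) monoid_scheme \<Rightarrow> nat \<Rightarrow> nat \<Rightarrow> 'a set set" where
  "Frob_orbits G q v =
     orbits (AutoGroup G\<lparr>carrier := Frob G q v\<rparr>) (carrier G - {\<one>\<^bsub>G\<^esub>}) (\<lambda>\<alpha>. \<alpha>)"

definition differences :: "('a, 'm) monoid_scheme \<Rightarrow> 'a pair_pre_digraph \<Rightarrow> 'a multiset" where
  "differences G B = image_mset (\<lambda>(x, y). x \<otimes>\<^bsub>G\<^esub> inv\<^bsub>G\<^esub> y) (mset_set (parcs B))"

definition list_of_differences ::
  "('a, 'm) monoid_scheme \<Rightarrow> 'a pair_pre_digraph multiset \<Rightarrow> 'a multiset" where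
  "list_of_differences G \<B> = (\<Sum>B \<in># \<B>. differences G B)"

definition evenly_distributed :: "'a multiset \<Rightarrow> 'a set set \<Rightarrow> bool" where
  "evenly_distributed M \<O> \<longleftrightarrow> (\<exists>m. \<forall>X \<in> \<O>. size (filter_mset (\<lambda>x. x \<in> X) M) = m)"

definition difference_family ::
  "('a, 'm) ring_scheme \<Rightarrow> 'a set \<Rightarrow> 'g pair_pre_digraph \<Rightarrow> nat \<Rightarrow>
     'a set pair_pre_digraph multiset \<Rightarrow> bool" where
  "difference_family K F \<Gamma> l \<B> \<longleftrightarrow>
     (\<forall>B \<in># \<B>. graph_subspace K F \<Gamma> B) \<and>
     (\<forall>x \<in> carrier (singer_group K F) - {\<one>\<^bsub>singer_group K F\<^esub>}.
        count (list_of_differences (singer_group K F) \<B>) x = l)"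

definition images_under ::
  "('a \<Rightarrow> 'a) set \<Rightarrow> 'a pair_pre_digraph multiset \<Rightarrow> 'a pair_pre_digraph multiset" where
  "images_under A \<B> = (\<Sum>B \<in># \<B>. image_mset (\<lambda>\<alpha>. graph_image \<alpha> B) (mset_set A))"

end

(*
The hypothesis on the number of Frobenius orbits says that there are as few of them as possible:
every orbit has at most v elements, so each has exactly v, and Frob acts semiregularly on the
nonidentity elements of the Singer group. Hence a difference d contributes to a nonidentity x in
exactly one of the v images when d lies in the orbit of x, and in none otherwise, and the
multiplicity of x in the differences of the full family is the number m of differences of I in the
orbit of x, which is independent of x. Double counting gives m ([v]_q - 1) = v |Delta I| = 2st, so
m = lambda. The images of a block are again Gamma-subspaces because x |-> x^q is additive on the
field and fixes the subfield of order q.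
*)

theory Submission
  imports Defs
begin

subsection \<open>Graphs\<close>

text \<open>The fibre of \<open>(x, y) \<mapsto> {x, y}\<close> over an edge consists of the arc and
  its reversal, distinct because there are no loops. This gives the factor 2 in
  \<open>2 * s * t\<close>.\<close>

lemma (in pair_graph) card_parcs: "card (parcs G) = 2 * card (graph_edges G)"
proof -
  have fin: "finite (parcs G)" by (rule pair_finite_arcs)
  have img: "graph_edges G = (\<lambda>(x, y). {x, y}) ` parcs G"
    by (auto simp: graph_edges_def)
  have fibre: "card {a \<in> parcs G. (\<lambda>(x, y). {x, y}) a = e} = 2" if e: "e \<in> graph_edges G" for e
  proof -
    obtain x y where xy: "(x, y) \<in> parcs G" "e = {x, y}"
      using e unfolding graph_edges_def by blast
    have "(y, x) \<in> parcs G"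
      using pair_sym_arcs xy(1) unfolding symmetric_def by (auto dest: symD)
    moreover have "x \<noteq> y"
      using pair_no_loops[OF xy(1)] by simp
    ultimately have "{a \<in> parcs G. (\<lambda>(x, y). {x, y}) a = e} = {(x, y), (y, x)}"
      using xy by (auto simp: doubleton_eq_iff)
    with \<open>x \<noteq> y\<close> show ?thesis by simp
  qed
  have "card (parcs G) = (\<Sum>e \<in> graph_edges G. card {a \<in> parcs G. (\<lambda>(x, y). {x, y}) a = e})"
    using sum.image_gen[OF fin, of "\<lambda>_. 1 :: nat" "\<lambda>(x, y). {x, y}"] by (simp add: img)
  also have "\<dots> = 2 * card (graph_edges G)"
    by (simp add: fibre)
  finally show ?thesis .
qed

lemma card_parcs_digraph_iso:
  assumes "digraph_iso (with_proj G) (with_proj H)"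
  shows "card (parcs H) = card (parcs G)"
proof -
  obtain f where f: "pre_digraph.digraph_isomorphism (with_proj G) f"
    and H: "with_proj H = app_iso f (with_proj G)"
    using assms by (auto simp: digraph_iso_def)
  have "parcs H = iso_arcs f ` parcs G"
    using arg_cong[OF H, of arcs] by simp
  with pre_digraph.digraph_isomorphism_inj_on_arcs[OF f] show ?thesis
    by (simp add: card_image)
qed

lemma
  assumes B: "pair_graph B" and inj: "inj_on f (pverts B)"
  shows pair_graph_graph_image: "pair_graph (graph_image f B)"
    and digraph_iso_graph_image: "digraph_iso (with_proj B) (with_proj (graph_image f B))"
proof -
  interpret B: pair_graph B by (rule B)
  have arcs_verts: "parcs B \<subseteq> pverts B \<times> pverts B"
    by (auto dest: B.in_arcsD1 B.in_arcsD2)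
  show "pair_graph (graph_image f B)"
  proof (unfold_locales, goal_cases)
    case 6
    have "sym (parcs B)" using B.pair_sym_arcs by (simp add: symmetric_def)
    then have "sym (map_prod f f ` parcs B)"
      by (fastforce simp: sym_def)
    then show ?case by (simp add: symmetric_def graph_image_def)
  qed (use B.pair_finite_verts B.pair_finite_arcs B.pair_no_loops arcs_verts inj in
        \<open>fastforce simp: graph_image_def inj_on_def\<close>)+
  \<comment> \<open>Arcs are pairs of vertices, so the arc map is forced to be
    \<open>map_prod f f\<close>, and head and tail remain the two projections.\<close>
  let ?h = "\<lparr>iso_verts = f, iso_arcs = map_prod f f, iso_head = snd, iso_tail = fst\<rparr>"
  have "inj_on (map_prod f f) (parcs B)"
    using map_prod_inj_on[OF inj inj] arcs_verts by (rule inj_on_subset)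
  moreover have "wf_digraph (with_proj B)" by unfold_locales
  ultimately have "pre_digraph.digraph_isomorphism (with_proj B) ?h"
    using inj by (simp add: pre_digraph.digraph_isomorphism_def)
  moreover have "with_proj (graph_image f B) = app_iso ?h (with_proj B)"
    by (simp add: with_proj_def app_iso_def graph_image_def)
  ultimately show "digraph_iso (with_proj B) (with_proj (graph_image f B))"
    unfolding digraph_iso_def by blast
qed

subsection \<open>Additivity of the Frobenius map\<close>

context cring
begin

lemma binomial_theorem:
  assumes [simp]: "x \<in> carrier R" "y \<in> carrier R"
  shows "(x \<oplus> y) [^] n = (\<Oplus>k\<in>{..n}. [(n choose k)] \<cdot> (x [^] k \<otimes> y [^] (n - k)))"
proof (induction n)
  case 0
  show ?case by simp
next
  case (Suc n)
  let ?a = "\<lambda>k. [(n choose k)] \<cdot> (x [^] Suc k \<otimes> y [^] (n - k))"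
  let ?b = "\<lambda>k. [(n choose k)] \<cdot> (x [^] k \<otimes> y [^] (Suc n - k))"
  let ?c = "\<lambda>k. [(Suc n choose k)] \<cdot> (x [^] k \<otimes> y [^] (Suc n - k))"
  have X: "(\<Oplus>k\<in>{..n}. [(n choose k)] \<cdot> (x [^] k \<otimes> y [^] (n - k))) \<otimes> x = (\<Oplus>k\<in>{..n}. ?a k)"
    by (subst finsum_ldistr)
       (auto intro!: finsum_cong' simp: add_pow_ldistr add_pow_rdistr m_ac)
  have Y: "(\<Oplus>k\<in>{..n}. [(n choose k)] \<cdot> (x [^] k \<otimes> y [^] (n - k))) \<otimes> y = (\<Oplus>k\<in>{..n}. ?b k)"
    by (subst finsum_ldistr)
       (auto intro!: finsum_cong' simp: add_pow_ldistr add_pow_rdistr m_ac Suc_diff_le)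
  \<comment> \<open>The added term \<open>k = Suc n\<close> vanishes because
    \<open>n choose Suc n = 0\<close>; the longer sum can then be split at
    \<open>k = 0\<close>.\<close>
  have "(\<Oplus>k\<in>{..n}. ?b k) = (\<Oplus>k\<in>{..Suc n}. ?b k)"
    by (subst finsum_Suc) (auto simp: binomial_eq_0)
  also have "\<dots> = (\<Oplus>k\<in>{..n}. ?b (Suc k)) \<oplus> ?b 0"
    by (subst finsum_Suc2) auto
  finally have Y': "(\<Oplus>k\<in>{..n}. ?b k) = (\<Oplus>k\<in>{..n}. ?b (Suc k)) \<oplus> ?b 0" .
  have "(\<Oplus>k\<in>{..Suc n}. ?c k) = (\<Oplus>k\<in>{..n}. ?c (Suc k)) \<oplus> ?c 0"
    by (subst finsum_Suc2) auto
  \<comment> \<open>Pascal's rule, term by term.\<close>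
  also have "(\<Oplus>k\<in>{..n}. ?c (Suc k)) = (\<Oplus>k\<in>{..n}. ?a k \<oplus> ?b (Suc k))"
    by (intro finsum_cong') (auto simp: add.nat_pow_mult)
  also have "\<dots> = (\<Oplus>k\<in>{..n}. ?a k) \<oplus> (\<Oplus>k\<in>{..n}. ?b (Suc k))"
    by (intro finsum_addf) auto
  finally have "(\<Oplus>k\<in>{..Suc n}. ?c k) = (\<Oplus>k\<in>{..n}. ?a k) \<oplus> (\<Oplus>k\<in>{..n}. ?b k)"
    unfolding Y' by (simp add: a_assoc)
  moreover have "(x \<oplus> y) [^] Suc n = (x \<oplus> y) [^] n \<otimes> x \<oplus> (x \<oplus> y) [^] n \<otimes> y"
    by (simp add: r_distr)
  ultimately show ?case
    using X Y Suc.IH by simp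
qed

text \<open>Writing \<open>x\<close> as \<open>\<one> \<otimes> x\<close> moves the factor
  \<open>p\<close> onto \<open>\<one>\<close>, where the characteristic kills it.\<close>

lemma add_pow_eq_zero_if_dvd:
  assumes "[p] \<cdot> \<one> = \<zero>" and "p dvd (n :: nat)" and x: "x \<in> carrier R"
  shows "[n] \<cdot> x = \<zero>"
proof -
  obtain m where n: "n = p * m" using assms(2) by (elim dvdE)
  have "[n] \<cdot> x = [m] \<cdot> ([p] \<cdot> (\<one> \<otimes> x))"
    using x by (simp add: n add.nat_pow_pow)
  also have "[p] \<cdot> (\<one> \<otimes> x) = ([p] \<cdot> \<one>) \<otimes> x"
    using x by (intro add_pow_ldistr[symmetric]) auto
  finally show ?thesis
    using assms(1) x by simp
qed

lemma freshmans_dream: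
  fixes p :: nat
  assumes p: "prime p" and char: "[p] \<cdot> \<one> = \<zero>"
    and [simp]: "x \<in> carrier R" "y \<in> carrier R"
  shows "(x \<oplus> y) [^] p = x [^] p \<oplus> y [^] p"
proof -
  let ?f = "\<lambda>k. [(p choose k)] \<cdot> (x [^] k \<otimes> y [^] (p - k))"
  have p0: "0 < p" using p by (rule prime_gt_0_nat)
  have "(x \<oplus> y) [^] p = (\<Oplus>k\<in>{..p}. ?f k)"
    by (rule binomial_theorem) auto
  \<comment> \<open>The prime \<open>p\<close> divides every inner binomial coefficient, so only the
    two ends survive.\<close>
  also have "\<dots> = (\<Oplus>k\<in>{0, p}. ?f k)"
  proof (rule add.finprod_mono_neutral_cong_right)
    show "\<And>i. i \<in> {..p} - {0, p} \<Longrightarrow> ?f i = \<zero>"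
      using p by (intro add_pow_eq_zero_if_dvd[OF char] dvd_choose_prime) auto
  qed auto
  also have "\<dots> = x [^] p \<oplus> y [^] p"
    using p0 by (simp add: a_comm)
  finally show ?thesis .
qed

lemma freshmans_dream_power:
  fixes p :: nat
  assumes "prime p" and "[p] \<cdot> \<one> = \<zero>" and "x \<in> carrier R" "y \<in> carrier R"
  shows "(x \<oplus> y) [^] (p ^ n) = x [^] (p ^ n) \<oplus> y [^] (p ^ n)"
proof (induction n)
  case (Suc n)
  then show ?case
    using assms by (simp only: power_Suc2 nat_pow_pow[symmetric] a_closed nat_pow_closed freshmans_dream)
qed (use assms in simp)

end

lemma (in domain) nat_pow_eq_zero_iff:
  "x \<in> carrier R \<Longrightarrow> x [^] (n :: nat) = \<zero> \<longleftrightarrow> x = \<zero> \<and> n > 0"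
  by (induction n) (auto dest: integral)

text \<open>By Lagrange in the additive group \<open>p ^ n\<close> kills \<open>\<one>\<close>.
  Since \<open>[(p ^ n)] \<cdot> \<one>\<close> is the \<open>n\<close>-th power of
  \<open>[p] \<cdot> \<one>\<close>, the absence of zero divisors gives the claim.\<close>

lemma (in domain) add_pow_one_eq_zero:
  fixes p :: nat
  assumes p: "prime p" and card: "card (carrier R) = p ^ n"
  shows "[p] \<cdot> \<one> = \<zero>"
proof -
  have pow: "[(p ^ k)] \<cdot> \<one> = ([p] \<cdot> \<one>) [^] k" for k
  proof (induction k)
    case (Suc k)
    have "[(p ^ Suc k)] \<cdot> \<one> = [p] \<cdot> ([(p ^ k)] \<cdot> \<one> \<otimes> \<one>)"
      by (simp add: add.nat_pow_pow mult.commute)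
    also have "\<dots> = [(p ^ k)] \<cdot> \<one> \<otimes> [p] \<cdot> \<one>"
      by (intro add_pow_rdistr[symmetric]) auto
    finally show ?case using Suc by simp
  qed simp
  have "[order (add_monoid R)] \<cdot> \<one> = \<zero>"
    using add.pow_order_eq_1[of \<one>] by (simp add: add_pow_def)
  then have "([p] \<cdot> \<one>) [^] n = \<zero>"
    using card by (simp add: order_def pow)
  then show ?thesis by (simp add: nat_pow_eq_zero_iff)
qed

subsection \<open>Differences and the Frobenius action\<close>

text \<open>An automorphism commutes with \<open>x \<otimes> inv y\<close>, and its injectivity on
  arcs preserves multiplicities.\<close>

lemma (in group) differences_graph_image:
  assumes \<alpha>: "\<alpha> \<in> auto G" and B: "pair_graph B" and verts: "pverts B \<subseteq> carrier G"
  shows "differences G (graph_image \<alpha> B) = image_mset \<alpha> (differences G B)"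
proof -
  interpret B: pair_graph B by (rule B)
  have hom: "\<alpha> \<in> hom G G" and inj: "inj_on \<alpha> (carrier G)"
    using \<alpha> by (auto simp: auto_def Bij_def bij_betw_def)
  interpret \<alpha>: group_hom G G \<alpha>
    using hom by unfold_locales
  have arcs: "parcs B \<subseteq> carrier G \<times> carrier G"
    using verts by (auto dest: B.in_arcsD1 B.in_arcsD2)
  have "inj_on (map_prod \<alpha> \<alpha>) (parcs B)"
    using map_prod_inj_on[OF inj inj] arcs by (rule inj_on_subset)
  then have "mset_set (parcs (graph_image \<alpha> B)) = image_mset (map_prod \<alpha> \<alpha>) (mset_set (parcs B))"
    by (simp add: graph_image_def image_mset_mset_set)
  then show ?thesis
    using arcs B.pair_finite_arcs unfolding differences_def
    by (auto simp: multiset.map_comp intro!: image_mset_cong)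
qed

lemma (in group) set_mset_differences:
  assumes B: "pair_graph B" and verts: "pverts B \<subseteq> carrier G"
  shows "set_mset (differences G B) \<subseteq> carrier G - {\<one>}"
proof -
  interpret B: pair_graph B by (rule B)
  have "x \<otimes> inv y \<in> carrier G - {\<one>}" if xy: "(x, y) \<in> parcs B" for x y
  proof -
    have c: "x \<in> carrier G" "y \<in> carrier G"
      using xy verts by (auto dest: B.in_arcsD1 B.in_arcsD2)
    have "x \<noteq> y" using B.pair_no_loops[OF xy] by simp
    with c have "x \<otimes> inv y \<noteq> \<one>"
      by (metis inv_closed inv_inv inv_equality)
    with c show ?thesis by simp
  qed
  then show ?thesis
    using B.pair_finite_arcs by (auto simp: differences_def)
qed

lemma set_mset_list_of_differences:
  "set_mset (list_of_differences G \<B>) = (\<Union>B \<in> set_mset \<B>. set_mset (differences G B))"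
  by (induction \<B>) (auto simp: list_of_differences_def)

lemma size_list_of_differences:
  assumes "\<And>B. B \<in># \<B> \<Longrightarrow> card (parcs B) = n"
  shows "size (list_of_differences G \<B>) = size \<B> * n"
  using assms by (induction \<B>) (auto simp: list_of_differences_def differences_def)

text \<open>Double counting of the pairs of an \<open>x\<close> in \<open>A\<close> and an
  occurrence \<open>d\<close> in \<open>M\<close> with \<open>P x d\<close>.\<close>

lemma sum_size_filter_mset:
  assumes "finite A" and "\<And>d. d \<in># M \<Longrightarrow> card {x \<in> A. P x d} = n"
  shows "(\<Sum>x \<in> A. size (filter_mset (P x) M)) = n * size M"
  using assms(2)
proof (induction M)
  case (add d M)
  have "(\<Sum>x \<in> A. size (filter_mset (P x) (add_mset d M)))
      = (\<Sum>x \<in> A. (if P x d then 1 else 0) + size (filter_mset (P x) M))"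
    by (intro sum.cong) auto
  also have "\<dots> = card {x \<in> A. P x d} + n * size M"
    using add assms(1) by (simp add: sum.distrib sum.If_cases Int_def)
  finally show ?case
    using add.prems by simp
qed simp

text \<open>The union is at most as large as the sum of the cardinalities, and one member smaller
  than \<open>v\<close> would push that sum below \<open>card \<O> * v\<close>.\<close>

lemma card_eq_bound_if_covering:
  assumes "finite \<O>" and "\<And>X. X \<in> \<O> \<Longrightarrow> card X \<le> v" and "card \<O> * v \<le> card (\<Union>\<O>)" and "X \<in> \<O>"
  shows "card X = v"
proof (rule ccontr)
  assume "card X \<noteq> v"
  then have "(\<Sum>X \<in> \<O>. card X) < (\<Sum>X \<in> \<O>. v)"
    using assms by (intro sum_strict_mono_ex1) (auto intro!: bexI[of _ X] simp: le_neq_implies_less)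
  with card_Union_le_sum_card[of \<O>] assms(3) show False by simp
qed

lemma mult_AutoGroup:
  "f \<in> auto G \<Longrightarrow> g \<in> auto G \<Longrightarrow> f \<otimes>\<^bsub>AutoGroup G\<^esub> g = compose (carrier G) f g"
  by (simp add: AutoGroup_def BijGroup_def auto_def)

section \<open>The Frobenius action on a finite commutative group\<close>

locale frobenius_action = comm_group G for G (structure) +
  fixes q v :: nat
  assumes fin: "finite (carrier G)" and period: "order G dvd q ^ v - 1"
    and q_pos: "q > 0" and v_pos: "v > 0"
begin

text \<open>The \<open>v\<close>-th iterate of Frobenius is the identity, by Lagrange and
  \<open>period\<close>.\<close>

lemma pow_period: "x \<in> carrier G \<Longrightarrow> x [^] (q ^ v) = x"
proof -
  assume x: "x \<in> carrier G"
  have "x [^] (q ^ v - 1) = \<one>"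
    using period x pow_order_eq_1 by (auto simp: nat_pow_pow[symmetric] elim!: dvdE)
  moreover have "q ^ v = Suc (q ^ v - 1)" using q_pos by simp
  ultimately show ?thesis using x by (metis nat_pow_Suc l_one)
qed

lemma frobenius_auto: "frobenius G q \<in> auto G"
proof -
  have "inj_on (\<lambda>x. x [^] q) (carrier G)"
  \<comment> \<open>The inverse of Frobenius is its iterate \<open>v - 1\<close>.\<close>
  proof (rule inj_on_inverseI[where g = "\<lambda>x. x [^] (q ^ (v - 1))"])
    fix x assume "x \<in> carrier G"
    then show "(x [^] q) [^] (q ^ (v - 1)) = x"
      using pow_period v_pos by (simp add: nat_pow_pow flip: power_Suc)
  qed
  then have "inj_on (frobenius G q) (carrier G)"
    by (simp add: frobenius_def inj_on_def)
  moreover have "frobenius G q ` carrier G \<subseteq> carrier G"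
    by (auto simp: frobenius_def)
  ultimately have "bij_betw (frobenius G q) (carrier G) (carrier G)"
    using fin by (simp add: bij_betw_def endo_inj_surj)
  then show "frobenius G q \<in> auto G"
    by (auto simp: auto_def Bij_def frobenius_def hom_def nat_pow_distrib)
qed

lemma frobenius_pow: "frobenius G q [^]\<^bsub>AutoGroup G\<^esub> i = (\<lambda>x \<in> carrier G. x [^] (q ^ i))"
proof -
  interpret A: group "AutoGroup G" by (rule AutoGroup)
  have carr: "carrier (AutoGroup G) = auto G" by (simp add: AutoGroup_def)
  show "frobenius G q [^]\<^bsub>AutoGroup G\<^esub> i = (\<lambda>x \<in> carrier G. x [^] (q ^ i))"
  proof (induction i)
    case 0
    show ?case by (auto simp: AutoGroup_def BijGroup_def)
  next
    case (Suc i)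
    have "(\<lambda>x \<in> carrier G. x [^] (q ^ i)) \<in> auto G"
      using A.nat_pow_closed[of "frobenius G q" i] frobenius_auto by (simp add: carr Suc del: restrict_apply)
    then have "frobenius G q [^]\<^bsub>AutoGroup G\<^esub> Suc i
        = compose (carrier G) (\<lambda>x \<in> carrier G. x [^] (q ^ i)) (frobenius G q)"
      using frobenius_auto unfolding A.nat_pow_Suc Suc by (rule mult_AutoGroup)
    also have "\<dots> = (\<lambda>x \<in> carrier G. x [^] (q ^ Suc i))"
      by (auto simp: compose_def frobenius_def nat_pow_pow fun_eq_iff)
    finally show ?case .
  qed
qed

text \<open>The \<open>i\<close>-th iterate of Frobenius in closed form, restricted to the carrier
  because members of \<open>auto G\<close> are extensional.\<close>

definition power_map :: "nat \<Rightarrow> 'a \<Rightarrow> 'a" where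
  "power_map i = (\<lambda>x \<in> carrier G. x [^] (q ^ i))"

text \<open>The Frobenius orbit of \<open>x\<close>, written as an image of \<open>{..<v}\<close> so
  that having size \<open>v\<close> amounts to injectivity in the exponent.\<close>

definition power_orbit :: "'a \<Rightarrow> 'a set" where
  "power_orbit x = (\<lambda>i. x [^] (q ^ i)) ` {..<v}"

lemma power_map_auto: "power_map i \<in> auto G"
proof -
  interpret A: group "AutoGroup G" by (rule AutoGroup)
  have "frobenius G q [^]\<^bsub>AutoGroup G\<^esub> i \<in> carrier (AutoGroup G)"
    using frobenius_auto by (intro A.nat_pow_closed) (simp add: AutoGroup_def)
  then show ?thesis
    by (simp add: frobenius_pow power_map_def) (simp add: AutoGroup_def)
qed

lemma Frob_eq: "Frob G q v = power_map ` {..<v}"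
proof -
  have "{0..v - 1} = {..<v}" using v_pos by auto
  then show ?thesis
    by (auto simp: Frob_def power_map_def frobenius_pow)
qed

lemma Frob_orbits_eq: "Frob_orbits G q v = power_orbit ` (carrier G - {\<one>})"
proof -
  have "orbit (AutoGroup G\<lparr>carrier := Frob G q v\<rparr>) (\<lambda>\<alpha>. \<alpha>) x = (\<lambda>\<alpha>. \<alpha> x) ` Frob G q v" for x
    by (auto simp: orbit_def)
  then have "orbit (AutoGroup G\<lparr>carrier := Frob G q v\<rparr>) (\<lambda>\<alpha>. \<alpha>) x = power_orbit x"
    if "x \<in> carrier G" for x
    using that by (simp add: Frob_eq power_orbit_def power_map_def image_image)
  then show ?thesis
    by (auto simp: Frob_orbits_def orbits_def)
qed

lemma power_orbit_sym:
  assumes x: "x \<in> carrier G" and y: "y \<in> power_orbit x"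
  shows "x \<in> power_orbit y"
proof -
  obtain i where i: "i < v" "y = x [^] (q ^ i)"
    using y by (auto simp: power_orbit_def)
  show ?thesis
  proof (cases "i = 0")
    case True
    with i x v_pos show ?thesis by (auto simp: power_orbit_def intro!: image_eqI[where x = 0])
  next
    \<comment> \<open>Iterating Frobenius \<open>v - i\<close> more times completes the period. The
      case \<open>i = 0\<close> is separate because \<open>v - 0\<close> is not below
      \<open>v\<close>.\<close>
    case False
    have "y [^] (q ^ (v - i)) = x"
      using i x pow_period[OF x] by (simp add: nat_pow_pow flip: power_add)
    with False i show ?thesis
      by (auto simp: power_orbit_def intro!: image_eqI[where x = "v - i"])
  qed
qed

lemma power_orbit_nontrivial:
  assumes "x \<in> carrier G - {\<one>}"
  shows "power_orbit x \<subseteq> carrier G - {\<one>}"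
proof -
  have "x [^] (q ^ i) \<noteq> \<one>" for i
  proof
    assume "x [^] (q ^ i) = \<one>"
    then have "power_map i x = power_map i \<one>"
      using assms by (simp add: power_map_def)
    moreover have "inj_on (power_map i) (carrier G)"
      using power_map_auto[of i] by (simp add: auto_def Bij_def bij_betw_def)
    ultimately show False
      using assms by (auto dest: inj_onD)
  qed
  with assms show ?thesis by (auto simp: power_orbit_def)
qed

end

text \<open>The number of orbits is the smallest possible, which forces every orbit to have the maximal size \<open>v\<close>.\<close>

locale semiregular_frobenius_action = frobenius_action +
  assumes card_orbits: "card (Frob_orbits G q v) * v = order G - 1"
    and nontrivial: "order G > 1"
begin

text \<open>The orbits cover the \<open>order G - 1\<close> nonidentity elements, which by
  \<open>card_orbits\<close> is \<open>v\<close> times their number, so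
  \<open>card_eq_bound_if_covering\<close> applies.\<close>

lemma card_power_orbit:
  assumes "x \<in> carrier G - {\<one>}"
  shows "card (power_orbit x) = v"
proof (rule card_eq_bound_if_covering[where \<O> = "Frob_orbits G q v"])
  show "finite (Frob_orbits G q v)"
    using fin by (simp add: Frob_orbits_eq)
  show "card X \<le> v" if "X \<in> Frob_orbits G q v" for X
    using that card_image_le[of "{..<v}"] by (auto simp: Frob_orbits_eq power_orbit_def)
  have "y \<in> power_orbit y" if "y \<in> carrier G" for y
    using that v_pos by (auto simp: power_orbit_def intro!: image_eqI[where x = 0])
  then have "carrier G - {\<one>} \<subseteq> \<Union>(Frob_orbits G q v)"
    by (auto simp: Frob_orbits_eq)
  moreover have "finite (\<Union>(Frob_orbits G q v))"
    using fin by (auto simp: Frob_orbits_eq power_orbit_def)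
  ultimately have "card (carrier G - {\<one>}) \<le> card (\<Union>(Frob_orbits G q v))"
    by (intro card_mono)
  then show "card (Frob_orbits G q v) * v \<le> card (\<Union>(Frob_orbits G q v))"
    by (simp add: card_orbits order_def)
qed (use assms in \<open>simp add: Frob_orbits_eq\<close>)

lemma inj_on_power:
  assumes "x \<in> carrier G - {\<one>}"
  shows "inj_on (\<lambda>i. x [^] (q ^ i)) {..<v}"
  using card_power_orbit[OF assms] by (intro eq_card_imp_inj_on) (auto simp: power_orbit_def)

text \<open>One nonidentity element already separates the \<open>v\<close> maps. Sums over
  \<open>Frob G q v\<close> can therefore be reindexed by \<open>i < v\<close> without collapsing
  terms.\<close>

lemma inj_on_power_map: "inj_on power_map {..<v}"
proof -
  have "carrier G - {\<one>} \<noteq> {}"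
  proof
    assume "carrier G - {\<one>} = {}"
    then have "carrier G = {\<one>}" by auto
    with nontrivial show False by (simp add: order_def)
  qed
  then obtain x where x: "x \<in> carrier G - {\<one>}" by blast
  have "inj_on (\<lambda>i. power_map i x) {..<v}"
    using inj_on_power[OF x] x by (simp add: power_map_def)
  then show ?thesis by (auto simp: inj_on_def)
qed

text \<open>By semiregularity an occurrence of \<open>d\<close> is sent to \<open>x\<close> by
  exactly one of the \<open>v\<close> maps if the two share an orbit, and by none otherwise.\<close>

lemma count_power_map_images:
  assumes "set_mset M \<subseteq> carrier G - {\<one>}" and x: "x \<in> carrier G - {\<one>}"
  shows "(\<Sum>i<v. count (image_mset (power_map i) M) x)
       = size (filter_mset (\<lambda>d. d \<in> power_orbit x) M)"
  using assms(1)
proof (induction M)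
  case (add d M)
  have d: "d \<in> carrier G - {\<one>}" using add.prems by simp
  have "(\<Sum>i<v. if power_map i d = x then 1 else 0 :: nat) = card {i \<in> {..<v}. d [^] (q ^ i) = x}"
    using d by (simp add: sum.If_cases Int_def power_map_def)
  also have "\<dots> = (if d \<in> power_orbit x then 1 else 0)"
  \<comment> \<open>The exponent \<open>i\<close> comes from \<open>x\<close> lying in the orbit of
    \<open>d\<close>, whereas the claim speaks of \<open>d\<close> in the orbit of \<open>x\<close>;
    \<open>power_orbit_sym\<close> links the two.\<close>
  proof (cases "x \<in> power_orbit d")
    case True
    then obtain i where i: "i < v" "x = d [^] (q ^ i)" by (auto simp: power_orbit_def)
    then have "{i \<in> {..<v}. d [^] (q ^ i) = x} = {i}"
      using inj_on_power[OF d] by (auto dest: inj_onD)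
    moreover have "d \<in> power_orbit x" using True d power_orbit_sym by blast
    ultimately show ?thesis by simp
  next
    case False
    then have "{i \<in> {..<v}. d [^] (q ^ i) = x} = {}" by (auto simp: power_orbit_def)
    moreover have "d \<notin> power_orbit x" using False x power_orbit_sym by blast
    ultimately show ?thesis by simp
  qed
  finally have step: "(\<Sum>i<v. if power_map i d = x then 1 else 0 :: nat)
      = (if d \<in> power_orbit x then 1 else 0)" .
  have "(\<Sum>i<v. count (image_mset (power_map i) (add_mset d M)) x)
      = (\<Sum>i<v. (if power_map i d = x then 1 else 0) + count (image_mset (power_map i) M) x)"
    by (intro sum.cong) auto
  then show ?case
    using add by (simp only: sum.distrib step) simp
qed simp

lemma count_differences_images_under:
  assumes "\<And>B. B \<in># \<I> \<Longrightarrow> pair_graph B \<and> pverts B \<subseteq> carrier G" and x: "x \<in> carrier G - {\<one>}"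
  shows "count (list_of_differences G (images_under (Frob G q v) \<I>)) x
       = size (filter_mset (\<lambda>d. d \<in> power_orbit x) (list_of_differences G \<I>))"
  using assms(1)
proof (induction \<I>)
  case empty
  show ?case by (simp add: list_of_differences_def images_under_def)
next
  case (add B \<I>)
  have B: "pair_graph B" "pverts B \<subseteq> carrier G" using add.prems by auto
  have "count (\<Sum>C \<in># image_mset (\<lambda>\<alpha>. graph_image \<alpha> B) (mset_set (Frob G q v)). differences G C) x
      = (\<Sum>\<alpha> \<in> Frob G q v. count (differences G (graph_image \<alpha> B)) x)"
    by (simp add: multiset.map_comp comp_def count_sum flip: sum_unfold_sum_mset)
  also have "\<dots> = (\<Sum>i<v. count (differences G (graph_image (power_map i) B)) x)"
    by (simp add: Frob_eq sum.reindex[OF inj_on_power_map])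
  also have "\<dots> = (\<Sum>i<v. count (image_mset (power_map i) (differences G B)) x)"
    using B by (simp add: differences_graph_image power_map_auto)
  also have "\<dots> = size (filter_mset (\<lambda>d. d \<in> power_orbit x) (differences G B))"
    using count_power_map_images[OF set_mset_differences[OF B] x] .
  finally show ?case
    using add by (simp add: list_of_differences_def images_under_def)
qed

lemma evenly_distributed_imp_count_eq:
  assumes blocks: "\<And>B. B \<in># \<I> \<Longrightarrow> pair_graph B \<and> pverts B \<subseteq> carrier G"
    and even: "evenly_distributed (list_of_differences G \<I>) (Frob_orbits G q v)"
    and size: "l * (order G - 1) = v * size (list_of_differences G \<I>)"
    and x: "x \<in> carrier G - {\<one>}"
  shows "count (list_of_differences G (images_under (Frob G q v) \<I>)) x = l"
proof -
  let ?M = "list_of_differences G \<I>"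
  obtain m where m: "size (filter_mset (\<lambda>d. d \<in> power_orbit y) ?M) = m"
    if "y \<in> carrier G - {\<one>}" for y
    using even unfolding evenly_distributed_def Frob_orbits_eq by blast
  \<comment> \<open>By symmetry, the \<open>y\<close> whose orbit contains \<open>d\<close> form the
    orbit of \<open>d\<close>.\<close>
  have "card {y \<in> carrier G - {\<one>}. d \<in> power_orbit y} = v" if "d \<in># ?M" for d
  proof -
    have d: "d \<in> carrier G - {\<one>}"
      using that blocks set_mset_differences by (fastforce simp: set_mset_list_of_differences)
    then have "{y \<in> carrier G - {\<one>}. d \<in> power_orbit y} = power_orbit d"
      using power_orbit_nontrivial[OF d] power_orbit_sym by blast
    with card_power_orbit[OF d] show ?thesis by simp
  qed
  then have "(\<Sum>y \<in> carrier G - {\<one>}. size (filter_mset (\<lambda>d. d \<in> power_orbit y) ?M)) = v * size ?M"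
    using fin by (intro sum_size_filter_mset) auto
  \<comment> \<open>Each nonidentity \<open>y\<close> contributes \<open>m\<close> to the double
    sum, and \<open>size\<close> rewrites its value \<open>v * size ?M\<close>.\<close>
  then have "m * (order G - 1) = l * (order G - 1)"
    using size m by (simp add: order_def mult.commute)
  then have "m = l" using nontrivial by simp
  with m[OF x] count_differences_images_under[OF blocks x] show ?thesis by simp
qed

end

subsection \<open>The Singer group of a finite field extension\<close>

text \<open>The division defining \<open>q_number\<close> is exact because \<open>q - 1\<close>
  divides \<open>q ^ n - 1\<close>.\<close>

lemma q_number_mult:
  assumes "q > 0"
  shows "q_number q n * (q - 1) = q ^ n - 1"
proof -
  obtain m where "q = Suc m" using assms by (cases q) auto
  moreover have "m dvd Suc m ^ n - 1"
  proof (induction n)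
    case (Suc n)
    have "Suc m ^ Suc n - 1 = (Suc m ^ n - 1) + m * Suc m ^ n" by simp
    with Suc show ?case by (simp only: dvd_add dvd_triv_left)
  qed simp
  ultimately show ?thesis by (simp add: q_number_def)
qed

lemma (in ring) subfield_pow_card:
  assumes F: "subfield F R" and "finite F" and x: "x \<in> F"
  shows "x [^] card F = x"
proof (cases "x = \<zero>")
  case True
  have "card F > 0" using assms by (auto simp: card_gt_0_iff)
  with True show ?thesis by (simp add: nat_pow_zero)
next
  case False
  interpret F: field "R\<lparr>carrier := F\<rparr>" by (rule subfield_iff(2)[OF F])
  interpret M: group "mult_of (R\<lparr>carrier := F\<rparr>)" by (rule F.field_mult_group)
  \<comment> \<open>Powers in the multiplicative group of \<open>F\<close> agree with powers in the
    ambient ring, so Lagrange can be applied there.\<close>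
  have pow: "y [^]\<^bsub>mult_of (R\<lparr>carrier := F\<rparr>)\<^esub> n = y [^] n" for y and n :: nat
    by (induction n) simp_all
  have "x [^] (card F - 1) = \<one>"
    using M.pow_order_eq_1[of x] F.order_mult_of x False \<open>finite F\<close> by (simp add: pow order_def)
  moreover have "card F = Suc (card F - 1)" using x \<open>finite F\<close> by (metis Suc_pred' card_gt_0_iff empty_iff)
  moreover have "x \<in> carrier R" using x subfieldE(3)[OF F] by auto
  ultimately show ?thesis by (metis nat_pow_Suc l_one)
qed

locale finite_field_extension = field K for K (structure) +
  fixes F :: "'a set" and q v :: nat
  assumes q: "primepow q" and v: "v > 0" and card_K: "card (carrier K) = q ^ v"
    and F: "subfield F K" and card_F: "card F = q"
begin

lemma q_gt_1: "q > 1"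
  using q by (rule primepow_gt_Suc_0[unfolded One_nat_def[symmetric]])

lemma finite_K: "finite (carrier K)"
  using card_K q_gt_1 by (intro card_ge_0_finite) simp

lemma finite_F: "finite F"
  using finite_K subfieldE(3)[OF F] by (rule rev_finite_subset)

text \<open>With \<open>q = p ^ k\<close>, the order \<open>p ^ (k * v)\<close> of \<open>K\<close>
  yields characteristic \<open>p\<close>, and \<open>q ^ i = p ^ (k * i)\<close>.\<close>

lemma power_q_add:
  assumes "x \<in> carrier K" "y \<in> carrier K"
  shows "(x \<oplus> y) [^] (q ^ i) = x [^] (q ^ i) \<oplus> y [^] (q ^ i)"
proof -
  obtain p k where p: "prime p" "q = p ^ k"
    using q by (auto simp: primepow_def)
  have "[p] \<cdot> \<one> = \<zero>"
    using p card_K by (intro add_pow_one_eq_zero[where n = "k * v"]) (simp_all add: power_mult)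
  from freshmans_dream_power[OF p(1) this assms, of "k * i"] show ?thesis
    by (simp add: p(2) power_mult)
qed

lemma power_ring_hom: "ring_hom_ring K K (\<lambda>x. x [^] (q ^ i))"
  by (intro ring_hom_ringI2 ring_axioms ring_hom_memI)
     (use power_q_add in \<open>auto simp: nat_pow_distrib\<close>)

lemma power_subfield: "x \<in> F \<Longrightarrow> x [^] (q ^ i) = x"
proof (induction i)
  case 0
  then show ?case using subfieldE(3)[OF F] by auto
next
  case (Suc i)
  have x: "x \<in> carrier K" using Suc.prems subfieldE(3)[OF F] by auto
  have "x [^] (q ^ Suc i) = (x [^] (q ^ i)) [^] q"
    using x by (simp add: nat_pow_pow mult.commute)
  then show ?case
    using Suc subfield_pow_card[OF F finite_F] by (simp add: card_F)
qed

text \<open>A ring homomorphism maps an \<open>F\<close>-subspace to a subspace over the image of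
  \<open>F\<close>, which is \<open>F\<close> itself because the powers fix it pointwise.\<close>

lemma subalgebra_power_image:
  assumes "subalgebra F W K"
  shows "subalgebra F ((\<lambda>x. x [^] (q ^ i)) ` W) K"
proof -
  have "(\<lambda>x. x [^] (q ^ i)) ` F = F"
    using power_subfield by (simp add: image_def)
  with ring_hom_ring.img_is_subalgebra[OF power_ring_hom subfieldE(3)[OF F] assms, of i] show ?thesis
    by simp
qed

lemma subgroup_F: "subgroup (F - {\<zero>}) (mult_of K)"
  using subgroup_mult_of[OF F] .

sublocale mult: comm_group "mult_of K"
  using field_mult_group by (rule group.group_comm_groupI) (auto simp: m_comm)

sublocale F_normal: normal "F - {\<zero>}" "mult_of K"
  using subgroup_F by (rule mult.subgroup_imp_normal)

text \<open>Lagrange for the subgroup of nonzero scalars, followed by cancelling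
  \<open>q - 1\<close>.\<close>

lemma order_singer_group: "order (singer_group K F) = q_number q v"
proof -
  have "card (rcosets\<^bsub>mult_of K\<^esub> (F - {\<zero>})) * card (F - {\<zero>}) = q ^ v - 1"
    using mult.lagrange[OF subgroup_F] finite_K by (simp add: order_mult_of order_def card_K)
  moreover have "card (F - {\<zero>}) = q - 1"
    using finite_F subringE(2)[OF subfieldE(1)[OF F]] by (simp add: card_F)
  ultimately have "card (rcosets\<^bsub>mult_of K\<^esub> (F - {\<zero>})) * (q - 1) = q_number q v * (q - 1)"
    using q_gt_1 q_number_mult[of q v] by simp
  then show ?thesis
    using q_gt_1 by (simp add: singer_group_def order_def FactGroup_def)
qed

sublocale singer: frobenius_action "singer_group K F" q v
proof (intro frobenius_action.intro frobenius_action_axioms.intro)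
  show "comm_group (singer_group K F)"
    unfolding singer_group_def by (rule mult.abelian_FactGroup[OF subgroup_F])
  show "finite (carrier (singer_group K F))"
    using finite_K by (simp add: singer_group_def carrier_FactGroup)
  show "order (singer_group K F) dvd q ^ v - 1"
    using q_number_mult[of q v] q_gt_1 by (metis dvd_triv_left order_singer_group less_trans zero_less_one)
qed (use q_gt_1 v in simp_all)

text \<open>Passes from Frobenius on points to Frobenius on representing vectors, where additivity
  is available.\<close>

lemma power_map_coset:
  assumes "x \<in> carrier K - {\<zero>}"
  shows "singer.power_map i ((F - {\<zero>}) #>\<^bsub>mult_of K\<^esub> x) = (F - {\<zero>}) #>\<^bsub>mult_of K\<^esub> (x [^] (q ^ i))"
proof -
  have "(F - {\<zero>}) #>\<^bsub>mult_of K\<^esub> x \<in> carrier (singer_group K F)"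
    using assms by (auto simp: singer_group_def carrier_FactGroup)
  moreover have "((F - {\<zero>}) #>\<^bsub>mult_of K\<^esub> x) [^]\<^bsub>singer_group K F\<^esub> (q ^ i)
      = (F - {\<zero>}) #>\<^bsub>mult_of K\<^esub> (x [^] (q ^ i))"
    using assms F_normal.FactGroup_pow[of x "q ^ i"] by (simp add: singer_group_def nat_pow_mult_of)
  ultimately show ?thesis by (simp add: singer.power_map_def)
qed

lemma projective_subspace_subset:
  assumes "projective_subspace K F S"
  shows "S \<subseteq> carrier (singer_group K F)"
  using assms subalgebra_in_carrier
  by (fastforce simp: projective_subspace_def singer_group_def carrier_FactGroup)

lemma projective_subspace_power_map:
  assumes "projective_subspace K F S"
  shows "projective_subspace K F (singer.power_map i ` S)"
proof -
  obtain W where W: "subalgebra F W K"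
    and S: "S = {(F - {\<zero>}) #>\<^bsub>mult_of K\<^esub> x | x. x \<in> W - {\<zero>}}"
    using assms by (auto simp: projective_subspace_def)
  have WK: "W \<subseteq> carrier K" using W by (rule subalgebra_in_carrier)
  \<comment> \<open>Powers of nonzero elements are nonzero, so removing zero commutes with taking
    the image.\<close>
  have "(\<lambda>x. x [^] (q ^ i)) ` W - {\<zero>} = (\<lambda>x. x [^] (q ^ i)) ` (W - {\<zero>})"
    using WK q_gt_1 by (auto simp: nat_pow_eq_zero_iff)
  moreover have "singer.power_map i ` S
      = (\<lambda>x. (F - {\<zero>}) #>\<^bsub>mult_of K\<^esub> (x [^] (q ^ i))) ` (W - {\<zero>})"
    unfolding S Setcompr_eq_image image_image
    using WK by (intro image_cong refl power_map_coset) auto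
  ultimately have "singer.power_map i ` S
      = {(F - {\<zero>}) #>\<^bsub>mult_of K\<^esub> x | x. x \<in> (\<lambda>x. x [^] (q ^ i)) ` W - {\<zero>}}"
    by (simp add: Setcompr_eq_image image_image)
  with subalgebra_power_image[OF W] show ?thesis
    unfolding projective_subspace_def by blast
qed

lemma graph_subspace_power_map:
  assumes "graph_subspace K F \<Gamma> B"
  shows "graph_subspace K F \<Gamma> (graph_image (singer.power_map i) B)"
proof -
  have B: "pair_graph B" "digraph_iso (with_proj \<Gamma>) (with_proj B)" "projective_subspace K F (pverts B)"
    using assms by (auto simp: graph_subspace_def)
  have "inj_on (singer.power_map i) (carrier (singer_group K F))"
    using singer.power_map_auto[of i] by (simp add: auto_def Bij_def bij_betw_def)
  then have inj: "inj_on (singer.power_map i) (pverts B)"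
    using projective_subspace_subset[OF B(3)] by (rule inj_on_subset)
  show ?thesis
    unfolding graph_subspace_def
  proof (intro conjI)
    show "digraph_iso (with_proj \<Gamma>) (with_proj (graph_image (singer.power_map i) B))"
      using B(2) digraph_iso_graph_image[OF B(1) inj] by (rule digraph_iso_trans)
    show "projective_subspace K F (pverts (graph_image (singer.power_map i) B))"
      using projective_subspace_power_map[OF B(3)] by (simp add: graph_image_def)
  qed (rule pair_graph_graph_image[OF B(1) inj])
qed

end

section \<open>The difference family generated by the initial blocks\<close>

theorem theorem5p13:
  fixes K :: "('a, 'm) ring_scheme" and F :: "'a set"
    and q v l s t :: nat
    and \<Gamma> :: "'g pair_pre_digraph"
    and \<I> :: "'a set pair_pre_digraph multiset"
  assumes "primepow q" and "prime v" and "l > 0"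
    and "field K" and "card (carrier K) = q ^ v"
    and "subfield F K" and "card F = q"
    and "pair_graph \<Gamma>" and "q_spaceable q \<Gamma>" and "card (graph_edges \<Gamma>) = s"
    and "t > 0" and "l * (q_number q v - 1) = 2 * s * t"
    and "v dvd t"
    and "size \<I> = t div v"
    and "\<forall>B \<in># \<I>. graph_subspace K F \<Gamma> B"
    and "real (card (Frob_orbits (singer_group K F) q v)) = (real (q_number q v) - 1) / real v"
    and "evenly_distributed (list_of_differences (singer_group K F) \<I>)
           (Frob_orbits (singer_group K F) q v)"
  shows "difference_family K F \<Gamma> l (images_under (Frob (singer_group K F) q v) \<I>)"
proof -
  have v1: "v > 1" using \<open>prime v\<close> by (rule prime_gt_1_nat)
  interpret finite_field_extension K F q v
    using assms v1 by (intro finite_field_extension.intro finite_field_extension_axioms.intro) auto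
  let ?G = "singer_group K F"
  \<comment> \<open>Otherwise \<open>q ^ v - 1 \<le> q - 1\<close>, contradicting
    \<open>v > 1\<close>. The bound makes the Singer group nontrivial and the natural subtraction
    below exact.\<close>
  have "q_number q v > 1"
  proof (rule ccontr)
    assume "\<not> q_number q v > 1"
    then have "q_number q v * (q - 1) \<le> 1 * (q - 1)"
      by (intro mult_right_mono) auto
    then have "q ^ v \<le> q ^ 1"
      using q_gt_1 by (subst (asm) q_number_mult) simp_all
    with v1 q_gt_1 show False
      by (subst (asm) power_increasing_iff) auto
  qed
  moreover have "card (Frob_orbits ?G q v) * v = q_number q v - 1"
  proof -
    have "real (card (Frob_orbits ?G q v) * v) = real (q_number q v) - 1"
      using assms(16) v1 by simp
    with \<open>q_number q v > 1\<close> show ?thesis by linarith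
  qed
  ultimately interpret singer: semiregular_frobenius_action ?G q v
    by unfold_locales (simp_all add: order_singer_group)
  have blocks: "pair_graph B \<and> pverts B \<subseteq> carrier ?G" if "B \<in># \<I>" for B
    using assms(15) that projective_subspace_subset by (auto simp: graph_subspace_def)
  have "card (parcs B) = 2 * s" if "B \<in># \<I>" for B
    using assms(15) that card_parcs_digraph_iso[of \<Gamma> B] pair_graph.card_parcs[OF \<open>pair_graph \<Gamma>\<close>] assms(10)
    by (simp add: graph_subspace_def)
  then have "size (list_of_differences ?G \<I>) = t div v * (2 * s)"
    using size_list_of_differences[of \<I> "2 * s" ?G] assms(14) by simp
  \<comment> \<open>As \<open>v\<close> divides \<open>t\<close>, the factor \<open>v\<close>
    cancels the division in \<open>t div v\<close>, leaving \<open>2 * s * t\<close>.\<close>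
  then have "l * (order ?G - 1) = v * size (list_of_differences ?G \<I>)"
    using assms(12) \<open>v dvd t\<close> by (auto simp: order_singer_group elim!: dvdE)
  then have "count (list_of_differences ?G (images_under (Frob ?G q v) \<I>)) x = l"
    if "x \<in> carrier ?G - {\<one>\<^bsub>?G\<^esub>}" for x
    using singer.evenly_distributed_imp_count_eq[OF blocks assms(17) _ that] by blast
  moreover have "graph_subspace K F \<Gamma> B" if B: "B \<in># images_under (Frob ?G q v) \<I>" for B
  proof -
    have "finite (Frob ?G q v)" by (simp add: singer.Frob_eq)
    then obtain C i where "C \<in># \<I>" "B = graph_image (singer.power_map i) C"
      using B by (auto simp: images_under_def singer.Frob_eq)
    with assms(15) graph_subspace_power_map show ?thesis by blast
  qed
  ultimately show ?thesis
    unfolding difference_family_def by blast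
qed

end
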